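(* Fix $\lambda\ge\epsilon>0$, $q\in(0,1)$ and $\delta\in(0,0.5)$. Under the threshold query model, there exists a two-arm quantile bandit instance $\nu\in\mathcal E$ with deterministic rewards such that any $(\epsilon,\delta)$-reliable algorithm requires $\Omega(\log(\lambda/\epsilon))$ arm pulls.
   Context: Setting. Arms $\mathcal A=\{1,2\}$, level $q\in(0,1)$, $\lambda>0$. An instance is a pair $\nu=(F_1,F_2)$ of CDFs on $\mathbb R$; each pull of arm $k$ yields an independent reward with CDF $F_k$. The instance has deterministic rewards if each $F_k$ is the CDF of a point mass. $Q_k(p)=\sup\{x\in\mathbb R:F_k(x)<p\}$. $\mathcal E$ is the set of instances with $Q_k(q)\in[0,\lambda]$ for each $k$. $\mathcal A_\epsilon(\nu)=\{k\in\mathcal A: Q_k(q)\ge\max_{a\in\mathcal A}Q_a(q)-\epsilon\}$. Threshold query model. At each step the learner (possibly randomized, adaptively from past feedback) chooses an arm $k$ and a threshold $\gamma$; a fresh reward $r\sim F_k$ is drawn and the learner only observes the bit $\mathbf 1\{r\le\gamma\}$. Each such step is one arm pull. The algorithm stops after a random number $\tau\in[0,\infty]$ of pulls and, upon stopping, outputs an arm $\hat k$. It is $(\epsilon,\delta)$-reliable if $\mathbb P_{\nu'}[\tau<\infty\text{ and }\hat k\notin\mathcal A_\epsilon(\nu')]\le\delta$ for every $\nu'\in\mathcal E$.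
   Formalization: The deterministic instance may depend on the algorithm (a minimax bound): for one instance fixed beforehand the claim fails, as some reliable algorithm stops on it after O_{q,δ}(1) pulls. The bound is on the expected number of pulls, with a constant depending only on δ. *)

theory Defs
  imports "HOL-Probability.Probability"
begin

datatype arm = Arm1 | Arm2

lemma UNIV_arm: "(UNIV :: arm set) = {Arm1, Arm2}"
  using arm.exhaust by auto

instance arm :: finite
  by standard (simp add: UNIV_arm)

type_synonym bandit = "arm \<Rightarrow> real \<Rightarrow> real"

definition is_cdf :: "(real \<Rightarrow> real) \<Rightarrow> bool" where
  "is_cdf F \<longleftrightarrow> (\<exists>M. real_distribution M \<and> F = cdf M)"

definition deterministic_rewards :: "bandit \<Rightarrow> bool" where
  "deterministic_rewards \<nu> \<longleftrightarrow> (\<forall>k. \<exists>x. \<nu> k = cdf (return borel x))"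

text \<open>For \<open>0 < p < 1\<close> and \<open>F\<close> a CDF, the set below is nonempty and bounded above,
  so the supremum in the reals is the true one.\<close>

definition quantile :: "(real \<Rightarrow> real) \<Rightarrow> real \<Rightarrow> real" where
  "quantile F p = Sup {x. F x < p}"

definition bandit_class :: "real \<Rightarrow> real \<Rightarrow> bandit set" where
  "bandit_class lam q = {\<nu>. \<forall>k. is_cdf (\<nu> k) \<and> quantile (\<nu> k) q \<in> {0..lam}}"

definition good_arms :: "real \<Rightarrow> real \<Rightarrow> bandit \<Rightarrow> arm set" where
  "good_arms q \<epsilon> \<nu> =
     {k. quantile (\<nu> k) q \<ge> Max (range (\<lambda>a. quantile (\<nu> a) q)) - \<epsilon>}"

text \<open>A randomized adaptive algorithm draws one internal seed \<open>s\<close> from a law on the reals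
  (which can encode an infinite sequence of random choices) and afterwards acts as a function of
  \<open>s\<close> and the list of bits observed so far. The arms and thresholds chosen earlier
  are determined by \<open>s\<close> and these bits, so they need not be passed as arguments.\<close>

record algorithm =
  seed_law :: "real measure"
  stop_rule :: "real \<Rightarrow> bool list \<Rightarrow> bool"
  arm_rule :: "real \<Rightarrow> bool list \<Rightarrow> arm"
  threshold_rule :: "real \<Rightarrow> bool list \<Rightarrow> real"
  recommendation :: "real \<Rightarrow> bool list \<Rightarrow> arm"

definition valid_algorithm :: "algorithm \<Rightarrow> bool" where
  "valid_algorithm alg \<longleftrightarrow>
     real_distribution (seed_law alg) \<and>
     (\<forall>h. (\<lambda>s. stop_rule alg s h) \<in> measurable borel (count_space UNIV) \<and>
          (\<lambda>s. arm_rule alg s h) \<in> measurable borel (count_space UNIV) \<and>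
          (\<lambda>s. threshold_rule alg s h) \<in> borel_measurable borel \<and>
          (\<lambda>s. recommendation alg s h) \<in> measurable borel (count_space UNIV))"

text \<open>An outcome is the seed together with a table of independent rewards, the entry
  \<open>(t, k)\<close> having CDF \<open>\<nu> k\<close>. Pull number \<open>t\<close> of the algorithm reads the
  entry of row \<open>t\<close> for the chosen arm, and no row is read twice, so each pull
  receives a fresh reward.\<close>

definition outcome_law :: "algorithm \<Rightarrow> bandit \<Rightarrow> (real \<times> (nat \<times> arm \<Rightarrow> real)) measure" where
  "outcome_law alg \<nu> =
     seed_law alg \<Otimes>\<^sub>M PiM UNIV (\<lambda>(t, k). interval_measure (\<nu> k))"

text \<open>The bits after \<open>t\<close> pulls, in chronological order and disregarding the stopping rule.\<close>

primrec history :: "algorithm \<Rightarrow> real \<times> (nat \<times> arm \<Rightarrow> real) \<Rightarrow> nat \<Rightarrow> bool list" where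
  "history alg \<omega> 0 = []"
| "history alg \<omega> (Suc t) =
     (let s = fst \<omega>; h = history alg \<omega> t; r = snd \<omega> (t, arm_rule alg s h)
      in h @ [r \<le> threshold_rule alg s h])"

definition stop_time :: "algorithm \<Rightarrow> real \<times> (nat \<times> arm \<Rightarrow> real) \<Rightarrow> enat" where
  "stop_time alg \<omega> =
     (if \<exists>t. stop_rule alg (fst \<omega>) (history alg \<omega> t)
      then enat (LEAST t. stop_rule alg (fst \<omega>) (history alg \<omega> t)) else \<infinity>)"

text \<open>Only meaningful when the stopping time is finite.\<close>

definition output_arm :: "algorithm \<Rightarrow> real \<times> (nat \<times> arm \<Rightarrow> real) \<Rightarrow> arm" where
  "output_arm alg \<omega> =
     recommendation alg (fst \<omega>) (history alg \<omega> (the_enat (stop_time alg \<omega>)))"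

definition reliable :: "real \<Rightarrow> real \<Rightarrow> real \<Rightarrow> real \<Rightarrow> algorithm \<Rightarrow> bool" where
  "reliable lam q \<epsilon> \<delta> alg \<longleftrightarrow>
     valid_algorithm alg \<and>
     (\<forall>\<nu>\<in>bandit_class lam q.
        measure (outcome_law alg \<nu>)
          {\<omega> \<in> space (outcome_law alg \<nu>).
             stop_time alg \<omega> < \<infinity> \<and> output_arm alg \<omega> \<notin> good_arms q \<epsilon> \<nu>} \<le> \<delta>)"

definition expected_pulls :: "algorithm \<Rightarrow> bandit \<Rightarrow> ennreal" where
  "expected_pulls alg \<nu> = (\<integral>\<^sup>+ \<omega>. ennreal_of_enat (stop_time alg \<omega>) \<partial>outcome_law alg \<nu>)"

text \<open>The lower bound is a minimax one: the hard instance is allowed to depend on the algorithm.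
  For a single instance fixed in advance no such bound holds, since with thresholds tuned to an
  instance with deterministic rewards a number of pulls depending only on \<open>q\<close> and
  \<open>\<delta>\<close> certifies its best arm, and an algorithm that finds no certificate may run
  longer or forever.\<close>

end

theory Submission
  imports Defs
begin

text \<open>
  Put \<open>N = \<lceil>\<lambda> / \<epsilon>\<rceil> - 1\<close> gaps of width \<open>d = \<lambda> / N > \<epsilon>\<close> on \<open>[0, \<lambda>]\<close>. For each gap \<open>i\<close>
  the ascending instance \<open>(i d, (i + 1) d)\<close> and its reversal have disjoint sets of acceptable
  arms, and only a threshold inside that gap tells them apart. For a fixed seed the algorithm asks
  at most \<open>2 ^ m - 1\<close> different queries in its first \<open>m\<close> pulls, one per bit history, so at most
  \<open>2 ^ m - 1\<close> gaps are resolved; on any other gap, stopping within \<open>m\<close> pulls is wrong for one of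
  the two instances. Averaging over seeds and gaps, some ascending instance is stopped within
  \<open>m\<close> pulls with probability at most \<open>2 \<delta> + (2 ^ m - 1) / N\<close>, and \<open>m\<close> of order
  \<open>log N\<close> keeps this bounded away from 1.
\<close>

section \<open>Deterministic instances and their quantiles\<close>

definition point_bandit :: "(arm \<Rightarrow> real) \<Rightarrow> bandit" where
  "point_bandit x = (\<lambda>k. cdf (return borel (x k)))"

text \<open>Under point-mass rewards every row of the outcome table is almost surely the same, so
  the seed is the only randomness left in a run.\<close>

definition reward_table :: "(arm \<Rightarrow> real) \<Rightarrow> nat \<times> arm \<Rightarrow> real" where
  "reward_table x = (\<lambda>(t, k). x k)"

abbreviation outcome_space :: "(real \<times> (nat \<times> arm \<Rightarrow> real)) measure" where
  "outcome_space \<equiv> borel \<Otimes>\<^sub>M PiM UNIV (\<lambda>_. borel)"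

lemma real_distribution_return: "real_distribution (return borel (x :: real))"
  by (simp add: real_distribution_def real_distribution_axioms_def prob_space_return)

text \<open>\<open>outcome_law\<close> rebuilds each reward law from its CDF. A real distribution is
  determined by its CDF, so for a deterministic arm the rebuilt law is the point mass
  itself.\<close>

lemma interval_measure_cdf:
  assumes "real_distribution M"
  shows "interval_measure (cdf M) = M"
proof -
  interpret real_distribution M by fact
  have "real_distribution (interval_measure (cdf M))"
    by (rule real_distribution_interval_measure)
      (use cdf_nondecreasing cdf_is_right_cont cdf_lim_at_top_prob cdf_lim_at_bot in auto)
  moreover have "cdf (interval_measure (cdf M)) = cdf M"
    by (rule cdf_interval_measure)
      (use cdf_nondecreasing cdf_is_right_cont cdf_lim_at_bot in auto)
  ultimately show ?thesis
    using assms cdf_unique by blast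
qed

lemma quantile_point_bandit:
  assumes "0 < q" "q < 1"
  shows "quantile (point_bandit x k) q = x k"
proof -
  \<comment> \<open>The CDF jumps from 0 to 1 at \<open>x k\<close>, and \<open>q\<close> lies
    strictly between these values.\<close>
  have "{y. point_bandit x k y < q} = {..<x k}"
    using assms by (auto simp: point_bandit_def cdf_def measure_return split: split_indicator)
  then show ?thesis
    by (simp add: quantile_def)
qed

lemma point_bandit_in_class:
  assumes "0 < q" "q < 1" "\<And>k. x k \<in> {0..lam}"
  shows "point_bandit x \<in> bandit_class lam q"
proof -
  have "is_cdf (point_bandit x k)" for k
    using real_distribution_return by (auto simp: is_cdf_def point_bandit_def)
  then show ?thesis
    using assms(3) by (auto simp: bandit_class_def quantile_point_bandit[OF assms(1,2)])
qed

lemma deterministic_point_bandit: "deterministic_rewards (point_bandit x)"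
  by (auto simp: deterministic_rewards_def point_bandit_def)

lemma good_arms_point_bandit:
  assumes "0 < q" "q < 1"
  shows "good_arms q \<epsilon> (point_bandit x) = {k. x k \<ge> max (x Arm1) (x Arm2) - \<epsilon>}"
  using assms by (simp add: good_arms_def quantile_point_bandit UNIV_arm)

section \<open>The outcome law of a deterministic instance\<close>

lemma pair_measure_return:
  assumes "y \<in> space N"
  shows "M \<Otimes>\<^sub>M return N y = distr M (M \<Otimes>\<^sub>M N) (\<lambda>s. (s, y))"
proof (rule measure_eqI)
  show "sets (M \<Otimes>\<^sub>M return N y) = sets (distr M (M \<Otimes>\<^sub>M N) (\<lambda>s. (s, y)))"
    by (simp cong: sets_pair_measure_cong)
next
  fix X assume "X \<in> sets (M \<Otimes>\<^sub>M return N y)"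
  moreover have "sets (M \<Otimes>\<^sub>M return N y) = sets (M \<Otimes>\<^sub>M N)"
    by (simp cong: sets_pair_measure_cong)
  ultimately have X: "X \<in> sets (M \<Otimes>\<^sub>M N)" "X \<in> sets (M \<Otimes>\<^sub>M return N y)"
    by auto
  interpret R: prob_space "return N y"
    using assms by (rule prob_space_return)
  have m: "(\<lambda>s. (s, y)) \<in> measurable M (M \<Otimes>\<^sub>M N)"
    using assms by simp
  have "emeasure (M \<Otimes>\<^sub>M return N y) X = (\<integral>\<^sup>+ s. emeasure (return N y) (Pair s -` X) \<partial>M)"
    by (rule R.emeasure_pair_measure_alt[OF X(2)])
  \<comment> \<open>The section of \<open>X\<close> at \<open>s\<close> has mass 1 or 0 under the
    point mass, according to whether \<open>(s, y)\<close> lies in \<open>X\<close>.\<close>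
  also have "\<dots> = (\<integral>\<^sup>+ s. indicator ((\<lambda>s. (s, y)) -` X \<inter> space M) s \<partial>M)"
    by (intro nn_integral_cong, subst emeasure_return)
      (use sets_Pair1[OF X(1)] in \<open>auto split: split_indicator\<close>)
  also have "\<dots> = emeasure M ((\<lambda>s. (s, y)) -` X \<inter> space M)"
    using m X(1) by (intro nn_integral_indicator measurable_sets)
  finally show "emeasure (M \<Otimes>\<^sub>M return N y) X = emeasure (distr M (M \<Otimes>\<^sub>M N) (\<lambda>s. (s, y))) X"
    using m X(1) by (simp add: emeasure_distr)
qed

text \<open>Each coordinate almost surely equals its atom. Countability of \<open>I\<close> merges
  the null sets, so the whole family is almost surely constant and its law is a point mass. The
  restriction appears because points of the product space are extensional functions.\<close>

lemma PiM_return_countable: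
  assumes "countable I"
    and [measurable]: "\<And>i. i \<in> I \<Longrightarrow> {a i} \<in> sets (M i)"
  shows "PiM I (\<lambda>i. return (M i) (a i)) = return (PiM I M) (restrict a I)"
proof -
  have [simp]: "a i \<in> space (M i)" if "i \<in> I" for i
    using assms(2)[OF that] by (meson insert_subset sets.sets_into_space)
  interpret prob_space "PiM I (\<lambda>i. return (M i) (a i))"
    by (intro prob_space_PiM prob_space_return) auto
  have "AE x in PiM I (\<lambda>i. return (M i) (a i)). \<forall>i\<in>I. x i = a i"
    unfolding AE_ball_countable[OF assms(1)]
    by (intro ballI AE_PiM_component prob_space_return) (auto simp: AE_return)
  moreover have "AE x in PiM I (\<lambda>i. return (M i) (a i)). x \<in> space (PiM I (\<lambda>i. return (M i) (a i)))"
    by simp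
  ultimately have "AE x in PiM I (\<lambda>i. return (M i) (a i)). x = restrict a I"
    by eventually_elim (auto simp: fun_eq_iff space_PiM PiE_def extensional_def)
  hence "PiM I (\<lambda>i. return (M i) (a i)) =
      return (PiM I (\<lambda>i. return (M i) (a i))) (restrict a I)"
    by (rule AE_eq_constD)
  also have "\<dots> = return (PiM I M) (restrict a I)"
    by (intro return_cong sets_PiM_cong) auto
  finally show ?thesis .
qed

text \<open>Through this push-forward, probabilities and expectations over outcomes become ones over
  the seed alone.\<close>

lemma outcome_law_point_bandit:
  assumes "valid_algorithm alg"
  shows "outcome_law alg (point_bandit x) =
           distr (seed_law alg) outcome_space (\<lambda>s. (s, reward_table x))"
proof -
  interpret real_distribution "seed_law alg"
    using assms by (simp add: valid_algorithm_def)
  have "(\<lambda>(t :: nat, k). interval_measure (point_bandit x k)) = (\<lambda>i. return borel (reward_table x i))"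
    by (auto simp: point_bandit_def reward_table_def fun_eq_iff
        interval_measure_cdf real_distribution_return)
  then have "outcome_law alg (point_bandit x) =
      seed_law alg \<Otimes>\<^sub>M return (PiM UNIV (\<lambda>_. borel)) (restrict (reward_table x) UNIV)"
    unfolding outcome_law_def by (simp only:) (subst PiM_return_countable, auto)
  also have "\<dots> = distr (seed_law alg) (seed_law alg \<Otimes>\<^sub>M PiM UNIV (\<lambda>_. borel)) (\<lambda>s. (s, reward_table x))"
    unfolding restrict_UNIV by (rule pair_measure_return) (simp add: space_PiM)
  also have "\<dots> = distr (seed_law alg) outcome_space (\<lambda>s. (s, reward_table x))"
    by (intro distr_cong refl sets_pair_measure_cong) simp
  finally show ?thesis .
qed

section \<open>Measurability of a run\<close>

lemma measurable_history:
  assumes "valid_algorithm alg"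
  shows "(\<lambda>\<omega>. history alg \<omega> t) \<in> measurable outcome_space (count_space UNIV)"
proof (induction t)
  case 0
  then show ?case by simp
next
  case (Suc t)
  have arm: "(\<lambda>\<omega>. arm_rule alg (fst \<omega>) h) \<in> measurable outcome_space (count_space UNIV)" for h
    using assms unfolding valid_algorithm_def by (intro measurable_compose[OF measurable_fst]) blast
  let ?bit = "\<lambda>h k \<omega>. snd \<omega> (t, k) \<le> threshold_rule alg (fst \<omega>) h"
  have bit: "Measurable.pred outcome_space (?bit h k)" for h k
    unfolding pred_def
  proof (rule borel_measurable_le)
    show "(\<lambda>\<omega>. snd \<omega> (t, k)) \<in> borel_measurable outcome_space"
      by (rule measurable_compose[OF measurable_snd measurable_component_singleton]) simp
    show "(\<lambda>\<omega>. threshold_rule alg (fst \<omega>) h) \<in> borel_measurable outcome_space"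
      using assms unfolding valid_algorithm_def by (intro measurable_compose[OF measurable_fst]) blast
  qed
  \<comment> \<open>With history and arm frozen the map is measurable. Both range over countable
    types, so first the arm and then the history may be made to depend on the outcome.\<close>
  have "(\<lambda>\<omega>. h @ [?bit h k \<omega>]) \<in> measurable outcome_space (count_space UNIV)" for h k
    by (rule measurable_compose[OF bit]) simp
  then have "(\<lambda>\<omega>. h @ [?bit h (arm_rule alg (fst \<omega>) h) \<omega>])
      \<in> measurable outcome_space (count_space UNIV)" for h
    using arm by (rule measurable_compose_countable[where f = "\<lambda>k \<omega>. h @ [?bit h k \<omega>]"])
  then have "(\<lambda>\<omega>. history alg \<omega> t @ [?bit (history alg \<omega> t) (arm_rule alg (fst \<omega>) (history alg \<omega> t)) \<omega>])
      \<in> measurable outcome_space (count_space UNIV)"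
    using Suc by (rule measurable_compose_countable
        [where f = "\<lambda>h \<omega>. h @ [?bit h (arm_rule alg (fst \<omega>) h) \<omega>]"])
  then show ?case
    by (simp add: Let_def)
qed

lemma measurable_stop_time:
  assumes "valid_algorithm alg"
  shows "stop_time alg \<in> measurable outcome_space (count_space UNIV)"
proof -
  have "Measurable.pred outcome_space (\<lambda>\<omega>. stop_rule alg (fst \<omega>) h)" for h
    using assms unfolding valid_algorithm_def by (intro measurable_compose[OF measurable_fst]) blast
  then have [measurable]: "Measurable.pred outcome_space (\<lambda>\<omega>. stop_rule alg (fst \<omega>) (history alg \<omega> t))" for t
    using measurable_history[OF assms]
    by (rule measurable_compose_countable[where f = "\<lambda>h \<omega>. stop_rule alg (fst \<omega>) h"])
  show ?thesis
    unfolding stop_time_def[abs_def] by measurable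
qed

lemma measurable_output_arm:
  assumes "valid_algorithm alg"
  shows "output_arm alg \<in> measurable outcome_space (count_space UNIV)"
proof -
  have "(\<lambda>\<omega>. recommendation alg (fst \<omega>) h) \<in> measurable outcome_space (count_space UNIV)" for h
    using assms unfolding valid_algorithm_def by (intro measurable_compose[OF measurable_fst]) blast
  then have "(\<lambda>\<omega>. recommendation alg (fst \<omega>) (history alg \<omega> (the_enat n)))
      \<in> measurable outcome_space (count_space UNIV)" for n
    using measurable_history[OF assms]
    by (rule measurable_compose_countable[where f = "\<lambda>h \<omega>. recommendation alg (fst \<omega>) h"])
  then show ?thesis
    unfolding output_arm_def[abs_def] using measurable_stop_time[OF assms]
    by (rule measurable_compose_countable
        [where f = "\<lambda>n \<omega>. recommendation alg (fst \<omega>) (history alg \<omega> (the_enat n))"])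
qed

section \<open>Runs that receive the same bits\<close>

lemma history_eq_while_unseparated:
  assumes "\<And>h a. length h < m \<Longrightarrow>
      (x a \<le> threshold_rule alg s h) = (y a \<le> threshold_rule alg s h)"
    and "t \<le> m"
  shows "history alg (s, reward_table x) t = history alg (s, reward_table y) t \<and>
         length (history alg (s, reward_table x) t) = t"
  using assms(2)
proof (induction t)
  case 0
  then show ?case by simp
next
  case (Suc t)
  let ?h = "history alg (s, reward_table x) t"
  have IH: "history alg (s, reward_table y) t = ?h" "length ?h = t"
    using Suc by auto
  \<comment> \<open>Equal seeds and histories give the same arm and threshold. The next query
    follows a history of length \<open>t < m\<close>, so the hypothesis makes its two answers
    agree.\<close>
  have "length ?h < m"
    using IH Suc.prems by simp
  from assms(1)[OF this, of "arm_rule alg s ?h"] show ?case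
    using IH by (simp add: Let_def) (simp add: reward_table_def)
qed

lemma stop_time_le_iff:
  "stop_time alg \<omega> \<le> enat m \<longleftrightarrow> (\<exists>t\<le>m. stop_rule alg (fst \<omega>) (history alg \<omega> t))"
proof -
  define P where "P = (\<lambda>t. stop_rule alg (fst \<omega>) (history alg \<omega> t))"
  have "(LEAST t. P t) \<le> m \<longleftrightarrow> (\<exists>t\<le>m. P t)" if "\<exists>t. P t"
    using that by (meson LeastI_ex Least_le le_trans)
  then show ?thesis
    by (auto simp: stop_time_def P_def)
qed

text \<open>A first stop within \<open>m\<close> pulls and its recommendation are read off the seed
  and the histories up to \<open>m\<close>; what the runs do later cannot matter.\<close>

lemma run_eq_if_histories_eq:
  assumes eq: "\<And>t. t \<le> m \<Longrightarrow> history alg (s, r) t = history alg (s, r') t"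
    and stop: "stop_time alg (s, r) \<le> enat m"
  shows "stop_time alg (s, r') = stop_time alg (s, r) \<and>
         output_arm alg (s, r') = output_arm alg (s, r)"
proof -
  define P where "P r t \<longleftrightarrow> stop_rule alg s (history alg (s, r) t)" for r t
  obtain t where t: "t \<le> m" "P r t"
    using stop by (auto simp: stop_time_le_iff P_def)
  have eqP: "P r' u = P r u" if "u \<le> m" for u
    using eq[OF that] by (simp add: P_def)
  have 1: "(LEAST u. P r u) \<le> m" "P r (LEAST u. P r u)"
    using t LeastI[of "P r"] Least_le[of "P r" t] by auto
  have "(LEAST u. P r' u) = (LEAST u. P r u)"
  proof (rule Least_equality)
    show "P r' (LEAST u. P r u)" using 1 eqP by simp
    \<comment> \<open>A stop \<open>y\<close> of the second run either lies beyond \<open>m\<close>,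
      hence after the first stop of the first run, or is a stop of the first run too.\<close>
    fix y assume "P r' y"
    then show "(LEAST u. P r u) \<le> y"
      using 1 eqP by (metis Least_le le_trans linear)
  qed
  moreover have "\<exists>u. P r u" "\<exists>u. P r' u"
    using t eqP by auto
  ultimately have st: "stop_time alg (s, r) = enat (LEAST u. P r u)"
      "stop_time alg (s, r') = enat (LEAST u. P r u)"
    by (simp_all add: stop_time_def P_def)
  with 1 eq show ?thesis
    by (simp add: output_arm_def)
qed

text \<open>For a fixed seed these lists are the nodes of the binary decision tree at which the
  first \<open>m\<close> queries are made.\<close>

lemma card_bool_lists_shorter:
  "finite {h :: bool list. length h < m} \<and> card {h :: bool list. length h < m} = 2 ^ m - 1"
proof (induction m)
  case 0
  then show ?case by simp
next
  case (Suc m)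
  have eq: "{h :: bool list. length h < Suc m} = {h. length h < m} \<union> {h. set h \<subseteq> UNIV \<and> length h = m}"
    by auto
  have "finite {h :: bool list. set h \<subseteq> UNIV \<and> length h = m}"
    by (rule finite_lists_length_eq) simp
  moreover have "card {h :: bool list. set h \<subseteq> UNIV \<and> length h = m} = 2 ^ m"
    by (subst card_lists_length_eq) auto
  moreover have "(1 :: nat) \<le> 2 ^ m" by simp
  ultimately show ?case
    unfolding eq using Suc by (subst card_Un_disjoint) auto
qed


section \<open>The ascending and descending instances\<close>

definition ascending :: "real \<Rightarrow> nat \<Rightarrow> arm \<Rightarrow> real" where
  "ascending d i k = (case k of Arm1 \<Rightarrow> real i * d | Arm2 \<Rightarrow> real (Suc i) * d)"

definition descending :: "real \<Rightarrow> nat \<Rightarrow> arm \<Rightarrow> real" where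
  "descending d i k = (case k of Arm1 \<Rightarrow> real (Suc i) * d | Arm2 \<Rightarrow> real i * d)"

text \<open>The strict inequality \<open>\<epsilon> < d\<close> matters: at
  \<open>\<epsilon> = d\<close> both arms would be acceptable.\<close>

lemma good_arms_ascending:
  assumes "0 < q" "q < 1" "0 < \<epsilon>" "\<epsilon> < d"
  shows "good_arms q \<epsilon> (point_bandit (ascending d i)) = {Arm2}"
proof (rule set_eqI)
  fix k
  show "k \<in> good_arms q \<epsilon> (point_bandit (ascending d i)) \<longleftrightarrow> k \<in> {Arm2}"
    unfolding good_arms_point_bandit[OF assms(1,2)]
    using assms by (cases k) (auto simp: ascending_def algebra_simps)
qed

lemma good_arms_descending:
  assumes "0 < q" "q < 1" "0 < \<epsilon>" "\<epsilon> < d"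
  shows "good_arms q \<epsilon> (point_bandit (descending d i)) = {Arm1}"
proof (rule set_eqI)
  fix k
  show "k \<in> good_arms q \<epsilon> (point_bandit (descending d i)) \<longleftrightarrow> k \<in> {Arm1}"
    unfolding good_arms_point_bandit[OF assms(1,2)]
    using assms by (cases k) (auto simp: descending_def algebra_simps)
qed

text \<open>Below \<open>i * d\<close> both bits are false and from \<open>(i + 1) * d\<close> on
  both are true, for either arm. A separating threshold thus lies in the half-open gap between, and
  rounding \<open>\<gamma> / d\<close> down recovers \<open>i\<close>.\<close>

lemma separating_threshold:
  assumes "0 < d" "(ascending d i a \<le> \<gamma>) \<noteq> (descending d i a \<le> \<gamma>)"
  shows "nat \<lfloor>\<gamma> / d\<rfloor> = i"
proof -
  have "real i * d \<le> \<gamma>" "\<gamma> < real (Suc i) * d"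
    using assms by (auto simp: ascending_def descending_def algebra_simps split: arm.splits)
  with \<open>0 < d\<close> have "real i \<le> \<gamma> / d" "\<gamma> / d < real i + 1"
    by (auto simp: field_simps)
  then have "\<lfloor>\<gamma> / d\<rfloor> = int i"
    by (simp add: floor_eq_iff)
  then show ?thesis by simp
qed

text \<open>A history fixes one threshold, which separates at most one gap whichever arm is pulled.
  Allowing every short history, reached or not, makes \<open>S\<close> depend on the thresholds
  only.\<close>

lemma separated_card_le:
  fixes \<gamma> :: "bool list \<Rightarrow> real" and m :: nat
  assumes "0 < d"
  defines "S \<equiv> {i. \<exists>h a. length h < m \<and> (ascending d i a \<le> \<gamma> h) \<noteq> (descending d i a \<le> \<gamma> h)}"
  shows "finite S" "card S \<le> 2 ^ m - 1"
proof -
  have sub: "S \<subseteq> (\<lambda>h. nat \<lfloor>\<gamma> h / d\<rfloor>) ` {h. length h < m}"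
    unfolding S_def using separating_threshold[OF assms(1)] by (force simp: image_iff)
  have fin: "finite {h :: bool list. length h < m}"
    using card_bool_lists_shorter by blast
  show "finite S"
    using sub fin by (rule finite_surj[rotated])
  show "card S \<le> 2 ^ m - 1"
    using surj_card_le[OF fin sub] card_bool_lists_shorter[of m] by simp
qed

section \<open>Events of the seed and their probabilities\<close>

definition wrong :: "algorithm \<Rightarrow> real \<Rightarrow> real \<Rightarrow> (arm \<Rightarrow> real) \<Rightarrow> real set" where
  "wrong alg q \<epsilon> x = {s. stop_time alg (s, reward_table x) < \<infinity> \<and>
     output_arm alg (s, reward_table x) \<notin> good_arms q \<epsilon> (point_bandit x)}"

definition stopped :: "algorithm \<Rightarrow> nat \<Rightarrow> (arm \<Rightarrow> real) \<Rightarrow> real set" where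
  "stopped alg m x = {s. stop_time alg (s, reward_table x) \<le> enat m}"

lemma seed_run_measurable:
  assumes "valid_algorithm alg"
  shows "wrong alg q \<epsilon> x \<in> sets borel" "stopped alg m x \<in> sets borel"
proof -
  have m: "(\<lambda>s. (s, reward_table x)) \<in> measurable borel outcome_space"
    by (simp add: space_PiM)
  have [measurable]: "(\<lambda>s. stop_time alg (s, reward_table x)) \<in> measurable borel (count_space UNIV)"
    "(\<lambda>s. output_arm alg (s, reward_table x)) \<in> measurable borel (count_space UNIV)"
    using measurable_compose[OF m measurable_stop_time[OF assms]]
      measurable_compose[OF m measurable_output_arm[OF assms]] by auto
  have "Measurable.pred borel (\<lambda>s. stop_time alg (s, reward_table x) < \<infinity> \<and>
     output_arm alg (s, reward_table x) \<notin> good_arms q \<epsilon> (point_bandit x))"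
    by measurable
  then show "wrong alg q \<epsilon> x \<in> sets borel"
    by (simp add: wrong_def pred_def)
  have "Measurable.pred borel (\<lambda>s. stop_time alg (s, reward_table x) \<le> enat m)"
    by measurable
  then show "stopped alg m x \<in> sets borel"
    by (simp add: stopped_def pred_def)
qed

lemma wrong_prob_le:
  assumes "reliable lam q \<epsilon> \<delta> alg" "0 < q" "q < 1" "\<And>k. x k \<in> {0..lam}"
  shows "measure (seed_law alg) (wrong alg q \<epsilon> x) \<le> \<delta>"
proof -
  have v: "valid_algorithm alg"
    using assms by (simp add: reliable_def)
  interpret real_distribution "seed_law alg"
    using v by (simp add: valid_algorithm_def)
  let ?E = "{\<omega> \<in> space outcome_space. stop_time alg \<omega> < \<infinity> \<and>
      output_arm alg \<omega> \<notin> good_arms q \<epsilon> (point_bandit x)}"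
  note measurable_stop_time[OF v, measurable] measurable_output_arm[OF v, measurable]
  have E: "?E \<in> sets outcome_space"
    by measurable
  have m: "(\<lambda>s. (s, reward_table x)) \<in> measurable (seed_law alg) outcome_space"
    by (simp add: space_PiM)
  have "measure (outcome_law alg (point_bandit x)) ?E = measure (seed_law alg) (wrong alg q \<epsilon> x)"
    unfolding outcome_law_point_bandit[OF v]
    by (subst measure_distr[OF m E])
      (auto simp: wrong_def space_pair_measure space_PiM intro!: arg_cong2[where f=measure])
  moreover have "space (outcome_law alg (point_bandit x)) = space outcome_space"
    by (simp add: outcome_law_point_bandit[OF v])
  moreover have "point_bandit x \<in> bandit_class lam q"
    by (rule point_bandit_in_class) fact+
  ultimately show ?thesis
    using assms(1) unfolding reliable_def by fastforce
qed

text \<open>This is Markov's inequality: a run not stopped within \<open>m\<close> pulls makes at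
  least \<open>m + 1\<close> of them, possibly infinitely many.\<close>

lemma expected_pulls_ge:
  assumes "valid_algorithm alg"
  shows "expected_pulls alg (point_bandit x) \<ge>
    ennreal ((real m + 1) * (1 - measure (seed_law alg) (stopped alg m x)))"
proof -
  interpret real_distribution "seed_law alg"
    using assms by (simp add: valid_algorithm_def)
  let ?T = "\<lambda>s. stop_time alg (s, reward_table x)"
  have m: "(\<lambda>s. (s, reward_table x)) \<in> measurable (seed_law alg) outcome_space"
    by (simp add: space_PiM)
  have S: "stopped alg m x \<in> sets (seed_law alg)"
    using seed_run_measurable[OF assms] by simp
  have "ennreal ((real m + 1) * (1 - measure (seed_law alg) (stopped alg m x))) =
      ennreal (real m + 1) * emeasure (seed_law alg) (UNIV - stopped alg m x)"
    using prob_compl[OF S] by (simp add: emeasure_eq_measure ennreal_mult)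
  also have "\<dots> = (\<integral>\<^sup>+ s. ennreal (real m + 1) * indicator (UNIV - stopped alg m x) s \<partial>seed_law alg)"
    using sets.compl_sets[OF S] by (intro nn_integral_cmult_indicator[symmetric]) simp
  also have "\<dots> \<le> (\<integral>\<^sup>+ s. ennreal_of_enat (?T s) \<partial>seed_law alg)"
  proof (rule nn_integral_mono)
    fix s
    show "ennreal (real m + 1) * indicator (UNIV - stopped alg m x) s \<le> ennreal_of_enat (?T s)"
    proof (cases "s \<in> stopped alg m x")
      case False
      then have "enat (Suc m) \<le> ?T s"
        by (auto simp: stopped_def Suc_ile_eq)
      then have "ennreal_of_enat (enat (Suc m)) \<le> ennreal_of_enat (?T s)"
        by (simp only: ennreal_of_enat_le_iff)
      also have "ennreal_of_enat (enat (Suc m)) = ennreal (real m + 1)"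
        by (simp add: ennreal_of_nat_eq_real_of_nat add.commute)
      finally show ?thesis using False by simp
    qed simp
  qed
  also have "\<dots> = expected_pulls alg (point_bandit x)"
    unfolding expected_pulls_def outcome_law_point_bandit[OF assms]
    using measurable_compose[OF measurable_stop_time[OF assms], of ennreal_of_enat borel]
    by (subst nn_integral_distr[OF m]) auto
  finally show ?thesis .
qed

text \<open>Both instances yield the same bits up to \<open>m\<close>, hence the same stop and
  recommendation. Their acceptable sets are disjoint, so this recommendation is wrong for one of
  them.\<close>

lemma stopped_imp_wrong:
  assumes "0 < q" "q < 1" "0 < \<epsilon>" "\<epsilon> < d"
    and unsep: "\<And>h a. length h < m \<Longrightarrow>
      (ascending d i a \<le> threshold_rule alg s h) = (descending d i a \<le> threshold_rule alg s h)"
    and stop: "s \<in> stopped alg m (ascending d i)"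
  shows "s \<in> wrong alg q \<epsilon> (ascending d i) \<union> wrong alg q \<epsilon> (descending d i)"
proof -
  let ?r = "reward_table (ascending d i)" and ?r' = "reward_table (descending d i)"
  have "stop_time alg (s, ?r') = stop_time alg (s, ?r) \<and> output_arm alg (s, ?r') = output_arm alg (s, ?r)"
    using stop history_eq_while_unseparated[of m "ascending d i" alg s "descending d i", OF unsep]
    by (intro run_eq_if_histories_eq[of m]) (auto simp: stopped_def)
  moreover have "stop_time alg (s, ?r) < \<infinity>"
    using stop order.strict_trans1[of _ "enat m" \<infinity>] by (simp add: stopped_def)
  ultimately show ?thesis
    using good_arms_ascending[OF assms(1-4), of i] good_arms_descending[OF assms(1-4), of i]
    by (cases "output_arm alg (s, ?r)") (auto simp: wrong_def)
qed

section \<open>Averaging over seeds and gaps\<close>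

lemma sum_stopped_le:
  fixes N m :: nat
  assumes rel: "reliable lam q \<epsilon> \<delta> alg" and q: "0 < q" "q < 1" and e: "0 < \<epsilon>" "\<epsilon> < d"
    and N: "real N * d \<le> lam"
  shows "(\<Sum>i<N. measure (seed_law alg) (stopped alg m (ascending d i))) \<le> 2 * \<delta> * N + (2 ^ m - 1)"
proof -
  have v: "valid_algorithm alg"
    using rel by (simp add: reliable_def)
  interpret real_distribution "seed_law alg"
    using v by (simp add: valid_algorithm_def)
  have d: "0 < d" using e by simp
  let ?S = "\<lambda>i. stopped alg m (ascending d i)"
  let ?A = "\<lambda>i. wrong alg q \<epsilon> (ascending d i)" and ?B = "\<lambda>i. wrong alg q \<epsilon> (descending d i)"
  have ms [measurable, simp]: "?S i \<in> sets borel" "?A i \<in> sets borel" "?B i \<in> sets borel" for i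
    using seed_run_measurable[OF v] by auto
  \<comment> \<open>The counting is done for one seed at a time: \<open>D\<close> collects the gaps
    its decision tree separates, and on every other gap an early stop is paid for by an
    error.\<close>
  have pw: "(\<Sum>i<N. indicator (?S i) s) \<le>
      (\<Sum>i<N. indicator (?A i) s + indicator (?B i) s) + (2 ^ m - 1 :: real)" for s
  proof -
    define D where "D = {i. \<exists>h a. length h < m \<and>
      (ascending d i a \<le> threshold_rule alg s h) \<noteq> (descending d i a \<le> threshold_rule alg s h)}"
    have D: "finite D" "card D \<le> 2 ^ m - 1"
      using separated_card_le[OF d] by (auto simp: D_def)
    have "indicator (?S i) s \<le> indicator (?A i) s + indicator (?B i) s + (indicator D i :: real)" for i
      using stopped_imp_wrong[OF q e, of m i alg s] unfolding D_def by (auto split: split_indicator)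
    then have "(\<Sum>i<N. indicator (?S i) s) \<le>
        (\<Sum>i<N. indicator (?A i) s + indicator (?B i) s + (indicator D i :: real))"
      by (intro sum_mono)
    also have "\<dots> = (\<Sum>i<N. indicator (?A i) s + indicator (?B i) s) + real (card ({..<N} \<inter> D))"
      by (simp add: sum.distrib indicator_def sum.If_cases)
    also have "card ({..<N} \<inter> D) \<le> 2 ^ m - 1"
      using D by (meson card_mono inf_le2 le_trans)
    then have "real (card ({..<N} \<inter> D)) \<le> 2 ^ m - 1"
      by (simp add: of_nat_diff flip: of_nat_le_iff[where 'a=real])
    finally show ?thesis by simp
  qed
  have range: "ascending d i k \<in> {0..lam}" "descending d i k \<in> {0..lam}" if "i < N" for i k
  proof -
    have "real (Suc i) * d \<le> real N * d"
      using that d by (intro mult_right_mono) auto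
    then show "ascending d i k \<in> {0..lam}" "descending d i k \<in> {0..lam}"
      using N d by (auto simp: ascending_def descending_def algebra_simps split: arm.splits)
  qed
  have int: "integrable (seed_law alg) (indicator X :: real \<Rightarrow> real)" if "X \<in> sets borel" for X
    using that by (simp add: emeasure_eq_measure)
  \<comment> \<open>Integrating \<open>pw\<close> over the seed turns indicators into probabilities;
    the constant is kept because the seed law has mass 1.\<close>
  have "(\<Sum>i<N. prob (?S i)) = (\<integral>s. (\<Sum>i<N. indicator (?S i) s) \<partial>seed_law alg)"
    by (subst Bochner_Integration.integral_sum) (auto intro: int)
  also have "\<dots> \<le> (\<integral>s. (\<Sum>i<N. indicator (?A i) s + indicator (?B i) s) + (2 ^ m - 1) \<partial>seed_law alg)"
    by (intro integral_mono pw Bochner_Integration.integrable_add Bochner_Integration.integrable_sum int) auto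
  also have "\<dots> = (\<integral>s. (\<Sum>i<N. indicator (?A i) s + indicator (?B i) s) \<partial>seed_law alg) + (2 ^ m - 1)"
    using prob_space
    by (subst Bochner_Integration.integral_add)
      (auto intro!: Bochner_Integration.integrable_add Bochner_Integration.integrable_sum int)
  also have "(\<integral>s. (\<Sum>i<N. indicator (?A i) s + indicator (?B i) s) \<partial>seed_law alg) =
      (\<Sum>i<N. prob (?A i) + prob (?B i))"
    by (subst Bochner_Integration.integral_sum)
      (auto intro!: Bochner_Integration.integrable_add int
        simp: Bochner_Integration.integral_add[OF int int])
  also have "(\<Sum>i<N. prob (?A i) + prob (?B i)) \<le> (\<Sum>i<N. \<delta> + \<delta>)"
    using wrong_prob_le[OF rel q] range by (intro sum_mono add_mono) auto
  finally show ?thesis by (simp add: algebra_simps)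
qed

lemma exists_slow_instance:
  fixes N m :: nat
  assumes rel: "reliable lam q \<epsilon> \<delta> alg" and q: "0 < q" "q < 1" and e: "0 < \<epsilon>" "\<epsilon> < d"
    and N: "real N * d \<le> lam" "0 < N"
  shows "\<exists>\<nu>\<in>bandit_class lam q. deterministic_rewards \<nu> \<and>
    expected_pulls alg \<nu> \<ge> ennreal ((real m + 1) * (1 - 2 * \<delta> - (2 ^ m - 1) / N))"
proof -
  let ?p = "\<lambda>i. measure (seed_law alg) (stopped alg m (ascending d i))"
  let ?b = "2 * \<delta> + (2 ^ m - 1) / real N"
  \<comment> \<open>The value \<open>?b\<close> is the bound of \<open>sum_stopped_le\<close>
    divided by \<open>N\<close>, and some term is at most the average. The gap found depends on the
    algorithm.\<close>
  have "\<exists>i<N. ?p i \<le> ?b"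
  proof (rule ccontr)
    assume "\<not> ?thesis"
    then have "(\<Sum>i<N. ?b) < (\<Sum>i<N. ?p i)"
      using N by (intro sum_strict_mono) (auto simp: not_le)
    moreover have "(\<Sum>i<N. ?b) = 2 * \<delta> * N + (2 ^ m - 1)"
      using N(2) by (simp add: field_simps)
    ultimately show False
      using sum_stopped_le[OF rel q e N(1), of m] by linarith
  qed
  then obtain i where i: "i < N" "?p i \<le> ?b"
    by blast
  have "real (Suc i) * d \<le> real N * d"
    using i e by (intro mult_right_mono) auto
  then have "point_bandit (ascending d i) \<in> bandit_class lam q"
    using N e by (intro point_bandit_in_class q) (auto simp: ascending_def algebra_simps split: arm.splits)
  moreover have "ennreal ((real m + 1) * (1 - 2 * \<delta> - (2 ^ m - 1) / N)) \<le> ennreal ((real m + 1) * (1 - ?p i))"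
    using i by (intro ennreal_leI mult_left_mono) auto
  ultimately show ?thesis
    using deterministic_point_bandit expected_pulls_ge[of alg m "ascending d i"] rel
    by (meson order_trans reliable_def)
qed

section \<open>Choice of the depth and the final bound\<close>

lemma exists_depth:
  fixes \<eta> :: real and N :: nat
  assumes "0 < \<eta>" "\<eta> \<le> 1"
  shows "\<exists>m. 2 ^ m - 1 \<le> \<eta> * N \<and> \<eta> * ln (1 + real N) \<le> real m + 1"
proof -
  let ?b = "1 + \<eta> * real N"
  have b: "1 \<le> ?b" using assms by simp
  \<comment> \<open>This is the largest \<open>m\<close> with
    \<open>2 ^ m \<le> 1 + \<eta> * N\<close>, so the decision tree separates at most a fraction
    \<open>\<eta>\<close> of the gaps.\<close>
  define m where "m = nat \<lfloor>log 2 ?b\<rfloor>"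
  have m: "real m \<le> log 2 ?b" "log 2 ?b \<le> real m + 1"
    using b by (auto simp: m_def of_nat_nat)
  have "2 powr real m \<le> ?b"
    using m(1) b by (simp add: le_log_iff)
  then have 1: "2 ^ m - 1 \<le> \<eta> * N"
    by (simp add: powr_realpow)
  \<comment> \<open>Since \<open>?b\<close> is a convex combination of \<open>1\<close> and
    \<open>1 + N\<close>, concavity of \<open>ln\<close> gives a loss of only the factor
    \<open>\<eta>\<close>, uniformly in \<open>N\<close>.\<close>
  have "(1 - \<eta>) * ln 1 + \<eta> * ln (1 + real N) \<le> ln ((1 - \<eta>) * 1 + \<eta> * (1 + real N))"
    using concave_onD[OF ln_concave, of \<eta> 1 "1 + real N"] assms by simp
  also have "(1 - \<eta>) * 1 + \<eta> * (1 + real N) = ?b"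
    by (simp add: algebra_simps)
  finally have "\<eta> * ln (1 + real N) \<le> ln ?b"
    by simp
  also have "ln ?b \<le> log 2 ?b"
    using b ln_2_less_1 mult_left_mono[of "ln 2" 1 "ln ?b"] by (simp add: log_def field_simps)
  finally have "\<eta> * ln (1 + real N) \<le> real m + 1"
    using m by simp
  with 1 show ?thesis by blast
qed

theorem theorem17:
  fixes \<delta> :: real
  assumes "0 < \<delta>" and "\<delta> < 1/2"
  shows "\<exists>c>0. \<forall>lam \<epsilon> q :: real. 0 < \<epsilon> \<and> \<epsilon> \<le> lam \<and> 0 < q \<and> q < 1 \<longrightarrow>
           (\<forall>alg. reliable lam q \<epsilon> \<delta> alg \<longrightarrow>
              (\<exists>\<nu>\<in>bandit_class lam q. deterministic_rewards \<nu> \<and>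
                 expected_pulls alg \<nu> \<ge> ennreal (c * ln (lam / \<epsilon>))))"
proof -
  \<comment> \<open>Half of the slack \<open>1 - 2 * \<delta>\<close> pays for the separated gaps;
    the other half remains as a lower bound on the probability of running past
    \<open>m\<close>.\<close>
  define \<eta> where "\<eta> = (1 - 2 * \<delta>) / 2"
  have \<eta>: "0 < \<eta>" "\<eta> \<le> 1"
    using assms by (auto simp: \<eta>_def)
  show ?thesis
  \<comment> \<open>One factor \<open>\<eta>\<close> comes from the depth, the other from the
    probability of running past it.\<close>
  proof (intro exI[of _ "\<eta>\<^sup>2"] conjI allI impI)
    show "0 < \<eta>\<^sup>2" using \<eta> by simp
  next
    fix lam \<epsilon> q :: real and alg
    assume *: "0 < \<epsilon> \<and> \<epsilon> \<le> lam \<and> 0 < q \<and> q < 1" and rel: "reliable lam q \<epsilon> \<delta> alg"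
    show "\<exists>\<nu>\<in>bandit_class lam q. deterministic_rewards \<nu> \<and>
        expected_pulls alg \<nu> \<ge> ennreal (\<eta>\<^sup>2 * ln (lam / \<epsilon>))"
    proof (cases "lam = \<epsilon>")
      case True
      \<comment> \<open>No gap wider than \<open>\<epsilon>\<close> fits into
        \<open>[0, lam]\<close> here, but the claimed bound is \<open>ln 1 = 0\<close>.\<close>
      then have "point_bandit (\<lambda>_. 0) \<in> bandit_class lam q"
        using * by (intro point_bandit_in_class) auto
      with True * deterministic_point_bandit show ?thesis by fastforce
    next
      case False
      \<comment> \<open>This is the largest integer strictly below \<open>lam / \<epsilon>\<close>,
        also when that ratio is an integer, so the gap width \<open>lam / N\<close> strictly exceeds
        \<open>\<epsilon>\<close>.\<close>
      define N where "N = nat (\<lceil>lam / \<epsilon>\<rceil> - 1)"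
      have "1 < lam / \<epsilon>" using False * by simp
      then have "1 \<le> \<lceil>lam / \<epsilon>\<rceil> - 1" by linarith
      then have N: "0 < N" "real N < lam / \<epsilon>" "lam / \<epsilon> \<le> 1 + real N"
        unfolding N_def by linarith+
      have d: "\<epsilon> < lam / N" "real N * (lam / N) \<le> lam"
        using N * by (auto simp: field_simps)
      obtain m where m: "2 ^ m - 1 \<le> \<eta> * N" "\<eta> * ln (1 + real N) \<le> real m + 1"
        using exists_depth[OF \<eta>] by blast
      have "(2 ^ m - 1) / real N \<le> \<eta>"
        using m(1) N by (simp add: field_simps)
      then have gap: "1 - 2 * \<delta> - (2 ^ m - 1) / real N \<ge> \<eta>"
        by (simp add: \<eta>_def)
      have "ln (lam / \<epsilon>) \<le> ln (1 + real N)"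
        using N(3) \<open>1 < lam / \<epsilon>\<close> by (intro ln_mono) auto
      then have "\<eta> * ln (lam / \<epsilon>) \<le> \<eta> * ln (1 + real N)"
        using \<eta> by (intro mult_left_mono) auto
      then have "\<eta> * ln (lam / \<epsilon>) \<le> real m + 1"
        using m(2) by simp
      with gap have "\<eta> * ln (lam / \<epsilon>) * \<eta> \<le> (real m + 1) * (1 - 2 * \<delta> - (2 ^ m - 1) / real N)"
        using \<eta> by (intro mult_mono) auto
      then have "ennreal (\<eta>\<^sup>2 * ln (lam / \<epsilon>)) \<le> ennreal ((real m + 1) * (1 - 2 * \<delta> - (2 ^ m - 1) / real N))"
        by (intro ennreal_leI) (simp add: power2_eq_square mult_ac)
      then show ?thesis
        using exists_slow_instance[OF rel _ _ _ d N(1), of m] * by (meson order_trans)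
    qed
  qed
qed

end
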